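(* Let $\mathcal{G}$ be a locally compact Hausdorff étale groupoid. Consider the following properties. (i) $\mathcal{G}$ has groupoid comparison and $M(\mathcal{G})=\emptyset$. (ii) $\mathcal{G}$ is purely infinite. (iii) $\mathcal{G}$ has paradoxical comparison. (iv) $\mathcal{G}$ is weakly purely infinite. Then (i)$\Rightarrow$(ii)$\Leftrightarrow$(iii)$\Rightarrow$(iv). If $\mathcal{G}$ is minimal, then (i)–(iv) are equivalent.
   Context: Standing assumption: all groupoids have infinite unit space. $\mathcal{G}^{(0)}$ is the unit space, $s(\gamma)=\gamma^{-1}\gamma$, $r(\gamma)=\gamma\gamma^{-1}$. For $D\subset \mathcal G^{(0)}$, $\mathcal G D=\{\gamma: s(\gamma)\in D\}$; $D$ is $\mathcal G$-invariant if $r(\mathcal G D)=D$. $\mathcal G$ is minimal if there are no proper non-empty closed $\mathcal G$-invariant subsets of $\mathcal G^{(0)}$. An open bisection is an open set $U\subset\mathcal G$ such that $s|_U$ and $r|_U$ are homeomorphisms onto open subsets of $\mathcal G^{(0)}$. For $K\subset\mathcal G^{(0)}$ compact and $V\subset\mathcal G^{(0)}$ open, $K\prec_{\mathcal G}V$ means there are open bisections $A_1,\dots,A_n$ with $K\subset\bigcup_i s(A_i)$ and with $r(A_1),\dots,r(A_n)$ pairwise disjoint subsets of $V$. For open $U,V$: $U\prec_{\mathcal G}V$ means $K\prec_{\mathcal G}V$ for every compact $K\subset U$; for non-empty open $U,V$, $U\prec_{\mathcal G,2}V$ means that for every compact $F\subset U$ there are disjoint non-empty open $O_1,O_2\subset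 V$ with $F\prec_{\mathcal G}O_1$ and $F\prec_{\mathcal G}O_2$. $M(\mathcal G)$ is the set of regular Borel probability measures $\mu$ on $\mathcal G^{(0)}$ with $\mu(r(U))=\mu(s(U))$ for every open bisection $U$. $\mathcal G$ has groupoid comparison if $U\prec_{\mathcal G}V$ for all open sets $U,V\subset\mathcal G^{(0)}$, $V\ne\emptyset$, with $\mu(U)<\mu(V)$ for all $\mu\in M(\mathcal G)$ (so if $M(\mathcal G)=\emptyset$ this means $U\prec_{\mathcal G}V$ for all non-empty open $U,V$). $\mathcal G$ is purely infinite (resp. weakly purely infinite) if $O_1\prec_{\mathcal G,2}O_2$ (resp. $O_1\prec_{\mathcal G}O_2$) for all non-empty open $O_1,O_2\subset\mathcal G^{(0)}$ with $O_1\subset r(\mathcal G O_2)$. $\mathcal G$ has paradoxical comparison if $O\prec_{\mathcal G,2}O$ for every non-empty open $O\subset\mathcal G^{(0)}$. *)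

theory Defs
  imports "HOL-Probability.Probability_Measure"
begin

(* The set of arrows is the topspace of arrow_top.  The operations mult and ginv are
   only meaningful on composable pairs and on arrows, respectively. *)
record 'a groupoid_struct =
  arrow_top :: "'a topology"
  composable :: "('a \<times> 'a) set"
  mult :: "'a \<Rightarrow> 'a \<Rightarrow> 'a" (infixl "\<odot>\<index>" 70)
  ginv :: "'a \<Rightarrow> 'a"

abbreviation arrows :: "'a groupoid_struct \<Rightarrow> 'a set" where
  "arrows G \<equiv> topspace (arrow_top G)"

definition src :: "'a groupoid_struct \<Rightarrow> 'a \<Rightarrow> 'a" where
  "src G \<gamma> = mult G (ginv G \<gamma>) \<gamma>"

definition rng :: "'a groupoid_struct \<Rightarrow> 'a \<Rightarrow> 'a" where
  "rng G \<gamma> = mult G \<gamma> (ginv G \<gamma>)"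

definition units :: "'a groupoid_struct \<Rightarrow> 'a set" where
  "units G = src G ` arrows G"

definition unit_top :: "'a groupoid_struct \<Rightarrow> 'a topology" where
  "unit_top G = subtopology (arrow_top G) (units G)"

(* The axioms of Hahn and Renault.  They imply that (a, b) is composable iff
   src G a = rng G b, and that units G is also the image of rng G. *)
locale groupoid =
  fixes G :: "'a groupoid_struct" (structure)
  assumes composable_subset: "composable G \<subseteq> arrows G \<times> arrows G"
    and mult_closed: "(a, b) \<in> composable G \<Longrightarrow> a \<odot> b \<in> arrows G"
    and ginv_closed: "a \<in> arrows G \<Longrightarrow> ginv G a \<in> arrows G"
    and ginv_ginv: "a \<in> arrows G \<Longrightarrow> ginv G (ginv G a) = a"
    and composable_mult_left:
      "\<lbrakk>(a, b) \<in> composable G; (b, c) \<in> composable G\<rbrakk> \<Longrightarrow> (a \<odot> b, c) \<in> composable G"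
    and composable_mult_right:
      "\<lbrakk>(a, b) \<in> composable G; (b, c) \<in> composable G\<rbrakk> \<Longrightarrow> (a, b \<odot> c) \<in> composable G"
    and mult_assoc:
      "\<lbrakk>(a, b) \<in> composable G; (b, c) \<in> composable G\<rbrakk> \<Longrightarrow> (a \<odot> b) \<odot> c = a \<odot> (b \<odot> c)"
    and composable_ginv: "a \<in> arrows G \<Longrightarrow> (ginv G a, a) \<in> composable G"
    and ginv_mult_cancel: "(a, b) \<in> composable G \<Longrightarrow> ginv G a \<odot> (a \<odot> b) = b"
    and mult_ginv_cancel: "(a, b) \<in> composable G \<Longrightarrow> (a \<odot> b) \<odot> ginv G b = a"

locale topological_groupoid = groupoid +
  assumes continuous_mult:
      "continuous_map
         (subtopology (prod_topology (arrow_top G) (arrow_top G)) (composable G))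
         (arrow_top G) (\<lambda>(a, b). a \<odot> b)"
    and continuous_ginv: "continuous_map (arrow_top G) (arrow_top G) (ginv G)"

(* f restricts to a homeomorphism of U onto an open subset of the unit space *)
definition homeo_onto_open_units :: "'a groupoid_struct \<Rightarrow> ('a \<Rightarrow> 'a) \<Rightarrow> 'a set \<Rightarrow> bool" where
  "homeo_onto_open_units G f U \<longleftrightarrow>
     openin (unit_top G) (f ` U) \<and>
     homeomorphic_map (subtopology (arrow_top G) U) (subtopology (unit_top G) (f ` U)) f"

(* It suffices to require that rng is a local homeomorphism: src is rng after ginv. *)
locale lch_etale_groupoid = topological_groupoid +
  assumes locally_compact: "locally_compact_space (arrow_top G)"
    and Hausdorff: "Hausdorff_space (arrow_top G)"
    and etale: "\<gamma> \<in> arrows G \<Longrightarrow>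
      \<exists>U. openin (arrow_top G) U \<and> \<gamma> \<in> U \<and> homeo_onto_open_units G (rng G) U"

definition open_bisection :: "'a groupoid_struct \<Rightarrow> 'a set \<Rightarrow> bool" where
  "open_bisection G U \<longleftrightarrow> openin (arrow_top G) U \<and>
     homeo_onto_open_units G (src G) U \<and> homeo_onto_open_units G (rng G) U"

definition arrows_from :: "'a groupoid_struct \<Rightarrow> 'a set \<Rightarrow> 'a set" where
  "arrows_from G D = {\<gamma> \<in> arrows G. src G \<gamma> \<in> D}"

definition invariant :: "'a groupoid_struct \<Rightarrow> 'a set \<Rightarrow> bool" where
  "invariant G D \<longleftrightarrow> D \<subseteq> units G \<and> rng G ` arrows_from G D = D"

definition minimal :: "'a groupoid_struct \<Rightarrow> bool" where
  "minimal G \<longleftrightarrow>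
     (\<forall>D. closedin (unit_top G) D \<and> invariant G D \<and> D \<noteq> {} \<longrightarrow> D = units G)"

(* K compact, V open *)
definition compact_subequiv :: "'a groupoid_struct \<Rightarrow> 'a set \<Rightarrow> 'a set \<Rightarrow> bool" where
  "compact_subequiv G K V \<longleftrightarrow>
     (\<exists>(n::nat) A. (\<forall>i<n. open_bisection G (A i)) \<and>
        K \<subseteq> (\<Union>i<n. src G ` A i) \<and>
        (\<forall>i<n. rng G ` A i \<subseteq> V) \<and>
        disjoint_family_on (\<lambda>i. rng G ` A i) {..<n})"

(* U and V open *)
definition open_subequiv :: "'a groupoid_struct \<Rightarrow> 'a set \<Rightarrow> 'a set \<Rightarrow> bool" where
  "open_subequiv G U V \<longleftrightarrow>
     (\<forall>K. compactin (unit_top G) K \<and> K \<subseteq> U \<longrightarrow> compact_subequiv G K V)"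

(* U and V open and non-empty *)
definition open_subequiv2 :: "'a groupoid_struct \<Rightarrow> 'a set \<Rightarrow> 'a set \<Rightarrow> bool" where
  "open_subequiv2 G U V \<longleftrightarrow>
     (\<forall>F. compactin (unit_top G) F \<and> F \<subseteq> U \<longrightarrow>
        (\<exists>O1 O2. openin (unit_top G) O1 \<and> openin (unit_top G) O2 \<and>
           O1 \<noteq> {} \<and> O2 \<noteq> {} \<and> O1 \<inter> O2 = {} \<and> O1 \<subseteq> V \<and> O2 \<subseteq> V \<and>
           compact_subequiv G F O1 \<and> compact_subequiv G F O2))"

definition borel_sets_of :: "'a topology \<Rightarrow> 'a set set" where
  "borel_sets_of X = sigma_sets (topspace X) {U. openin X U}"

definition regular_borel_prob_measure :: "'a topology \<Rightarrow> 'a measure \<Rightarrow> bool" where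
  "regular_borel_prob_measure X \<mu> \<longleftrightarrow>
     space \<mu> = topspace X \<and> sets \<mu> = borel_sets_of X \<and> prob_space \<mu> \<and>
     (\<forall>B \<in> borel_sets_of X.
        emeasure \<mu> B = (INF U \<in> {U. openin X U \<and> B \<subseteq> U}. emeasure \<mu> U) \<and>
        emeasure \<mu> B = (SUP K \<in> {K. compactin X K \<and> K \<subseteq> B}. emeasure \<mu> K))"

definition invariant_measures :: "'a groupoid_struct \<Rightarrow> 'a measure set" where
  "invariant_measures G =
     {\<mu>. regular_borel_prob_measure (unit_top G) \<mu> \<and>
         (\<forall>U. open_bisection G U \<longrightarrow> emeasure \<mu> (rng G ` U) = emeasure \<mu> (src G ` U))}"

definition groupoid_comparison :: "'a groupoid_struct \<Rightarrow> bool" where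
  "groupoid_comparison G \<longleftrightarrow>
     (\<forall>U V. openin (unit_top G) U \<and> openin (unit_top G) V \<and> V \<noteq> {} \<and>
        (\<forall>\<mu> \<in> invariant_measures G. emeasure \<mu> U < emeasure \<mu> V) \<longrightarrow> open_subequiv G U V)"

definition purely_infinite :: "'a groupoid_struct \<Rightarrow> bool" where
  "purely_infinite G \<longleftrightarrow>
     (\<forall>O1 O2. openin (unit_top G) O1 \<and> openin (unit_top G) O2 \<and> O1 \<noteq> {} \<and> O2 \<noteq> {} \<and>
        O1 \<subseteq> rng G ` arrows_from G O2 \<longrightarrow> open_subequiv2 G O1 O2)"

definition weakly_purely_infinite :: "'a groupoid_struct \<Rightarrow> bool" where
  "weakly_purely_infinite G \<longleftrightarrow>
     (\<forall>O1 O2. openin (unit_top G) O1 \<and> openin (unit_top G) O2 \<and> O1 \<noteq> {} \<and> O2 \<noteq> {} \<and>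
        O1 \<subseteq> rng G ` arrows_from G O2 \<longrightarrow> open_subequiv G O1 O2)"

definition paradoxical_comparison :: "'a groupoid_struct \<Rightarrow> bool" where
  "paradoxical_comparison G \<longleftrightarrow>
     (\<forall>W. openin (unit_top G) W \<and> W \<noteq> {} \<longrightarrow> open_subequiv2 G W W)"

end

(* A subset of G is an open bisection iff it is open and source and range are injective on it, and
   products of open bisections are open bisections; hence comparison of a compact set K with an open
   set V can be pushed along bisections: K below V gives a compact L inside V such that L below W
   implies K below W.  Under paradoxical comparison this iterates to place K below any number of
   disjoint open subsets of V.  If K is contained in r(GV), finitely many bisections carry pieces of K
   into V with overlapping images; sending each piece into its own disjoint copy removes the overlaps.
   In the minimal case r(GV) is the whole unit space, so weak pure infiniteness puts the unit space
   below each of two disjoint open sets, and an invariant probability measure would give both of them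
   measure 1. *)
theory Submission
  imports Defs
begin

subsection \<open>Algebra of groupoids\<close>

context groupoid
begin

lemma composable_arrows: "(a, b) \<in> composable G \<Longrightarrow> a \<in> arrows G \<and> b \<in> arrows G"
  using composable_subset by blast

lemma composable_self_ginv: "a \<in> arrows G \<Longrightarrow> (a, ginv G a) \<in> composable G"
  using composable_ginv[of "ginv G a"] ginv_closed ginv_ginv by simp

text \<open>Left multiplication by \<open>src G a\<close> fixes \<open>b\<close>; cancelling
  \<open>b\<close> on the right of this identity leaves
  \<open>src G a = b \<odot> ginv G b\<close>.\<close>

lemma composable_imp_src_eq_rng:
  assumes "(a, b) \<in> composable G"
  shows "src G a = rng G b"
proof -
  have ab: "a \<in> arrows G" "b \<in> arrows G"
    using assms composable_arrows by blast+
  have c1: "(ginv G a, a) \<in> composable G"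
    using ab composable_ginv by blast
  have c2: "(src G a, b) \<in> composable G"
    unfolding src_def using c1 assms composable_mult_left by blast
  have "src G a \<odot> b = b"
    unfolding src_def using mult_assoc[OF c1 assms] ginv_mult_cancel[OF assms] by simp
  with mult_ginv_cancel[OF c2] show ?thesis
    by (simp add: rng_def)
qed

lemma mult_src:
  assumes "a \<in> arrows G"
  shows "(a, src G a) \<in> composable G" "a \<odot> src G a = a"
proof -
  have c: "(a, ginv G a) \<in> composable G" "(ginv G a, a) \<in> composable G"
    using assms composable_self_ginv composable_ginv by blast+
  show "(a, src G a) \<in> composable G"
    unfolding src_def using c composable_mult_right by blast
  have "a \<odot> src G a = (a \<odot> ginv G a) \<odot> a"
    unfolding src_def using mult_assoc[OF c] by simp
  also have "\<dots> = a"
    using mult_ginv_cancel[OF c(1)] ginv_ginv[OF assms] by simp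
  finally show "a \<odot> src G a = a" .
qed

text \<open>For the converse, \<open>a\<close> composes with the unit \<open>src G a\<close>, and
  this unit, being \<open>rng G b\<close>, composes with \<open>b\<close>; the axioms on triple
  products chain the two.\<close>

lemma composable_iff:
  "(a, b) \<in> composable G \<longleftrightarrow> a \<in> arrows G \<and> b \<in> arrows G \<and> src G a = rng G b"
proof
  show "a \<in> arrows G \<and> b \<in> arrows G \<and> src G a = rng G b" if "(a, b) \<in> composable G"
    using that composable_arrows composable_imp_src_eq_rng by blast
next
  assume *: "a \<in> arrows G \<and> b \<in> arrows G \<and> src G a = rng G b"
  have "(rng G b, b) \<in> composable G"
    unfolding rng_def using * composable_mult_left composable_self_ginv composable_ginv by blast
  then show "(a, b) \<in> composable G"
    using * mult_src[of a] composable_mult_left[of a "src G a" b] by simp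
qed

lemma src_ginv: "a \<in> arrows G \<Longrightarrow> src G (ginv G a) = rng G a"
  and rng_ginv: "a \<in> arrows G \<Longrightarrow> rng G (ginv G a) = src G a"
  by (simp_all add: src_def rng_def ginv_ginv)

text \<open>The product \<open>a \<odot> b\<close> composes with \<open>ginv G b\<close>, so its
  source is the range of \<open>ginv G b\<close>.\<close>

lemma src_mult: "(a, b) \<in> composable G \<Longrightarrow> src G (a \<odot> b) = src G b"
  using composable_mult_right composable_mult_left composable_self_ginv composable_imp_src_eq_rng
    rng_ginv composable_arrows by metis

lemma rng_mult: "(a, b) \<in> composable G \<Longrightarrow> rng G (a \<odot> b) = rng G a"
  using composable_mult_right composable_ginv composable_imp_src_eq_rng
    src_ginv composable_arrows by metis

lemma src_in_units: "a \<in> arrows G \<Longrightarrow> src G a \<in> units G"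
  by (simp add: units_def)

lemma rng_in_units: "a \<in> arrows G \<Longrightarrow> rng G a \<in> units G"
  using src_in_units[OF ginv_closed] src_ginv by simp

lemma units_subset_arrows: "units G \<subseteq> arrows G"
  using mult_src(1) composable_arrows by (auto simp: units_def)

lemma src_unit: "u \<in> units G \<Longrightarrow> src G u = u"
  using src_mult mult_src by (fastforce simp: units_def)

lemma rng_unit: "u \<in> units G \<Longrightarrow> rng G u = u"
  using composable_imp_src_eq_rng mult_src(1) by (fastforce simp: units_def)

lemma topspace_unit_top [simp]: "topspace (unit_top G) = units G"
  using units_subset_arrows by (auto simp: unit_top_def)

lemma subset_rng_arrows_from:
  assumes "D \<subseteq> units G"
  shows "D \<subseteq> rng G ` arrows_from G D"
proof
  fix u assume "u \<in> D"
  then have "u \<in> arrows_from G D" "rng G u = u"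
    using assms src_unit rng_unit units_subset_arrows by (auto simp: arrows_from_def)
  then show "u \<in> rng G ` arrows_from G D"
    by (metis imageI)
qed

end

subsection \<open>Open bisections\<close>

context topological_groupoid
begin

lemma continuous_map_mult:
  assumes "continuous_map X (arrow_top G) f" "continuous_map X (arrow_top G) g"
    and "\<And>x. x \<in> topspace X \<Longrightarrow> (f x, g x) \<in> composable G"
  shows "continuous_map X (arrow_top G) (\<lambda>x. f x \<odot> g x)"
proof -
  have "continuous_map X
      (subtopology (prod_topology (arrow_top G) (arrow_top G)) (composable G)) (\<lambda>x. (f x, g x))"
    using assms by (auto intro!: continuous_map_into_subtopology continuous_map_pairedI)
  from continuous_map_compose[OF this continuous_mult] show ?thesis
    by (simp add: o_def)
qed

lemma continuous_map_src: "continuous_map (arrow_top G) (unit_top G) (src G)"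
proof -
  have "continuous_map (arrow_top G) (arrow_top G) (src G)"
    unfolding src_def
    by (intro continuous_map_mult continuous_ginv continuous_map_id[unfolded id_def])
       (simp add: composable_ginv)
  then show ?thesis
    unfolding unit_top_def
    by (rule continuous_map_into_subtopology) (auto simp: src_in_units)
qed

lemma continuous_map_rng: "continuous_map (arrow_top G) (unit_top G) (rng G)"
proof -
  have "continuous_map (arrow_top G) (arrow_top G) (rng G)"
    unfolding rng_def
    by (intro continuous_map_mult continuous_ginv continuous_map_id[unfolded id_def])
       (simp add: composable_self_ginv)
  then show ?thesis
    unfolding unit_top_def
    by (rule continuous_map_into_subtopology) (auto simp: rng_in_units)
qed

lemma openin_src_preimage:
  "openin (arrow_top G) A \<Longrightarrow> openin (unit_top G) W \<Longrightarrow> openin (arrow_top G) {a \<in> A. src G a \<in> W}"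
  by (rule openin_continuous_map_preimage_gen[OF continuous_map_src])

lemma openin_rng_preimage:
  "openin (arrow_top G) A \<Longrightarrow> openin (unit_top G) W \<Longrightarrow> openin (arrow_top G) {a \<in> A. rng G a \<in> W}"
  by (rule openin_continuous_map_preimage_gen[OF continuous_map_rng])

lemma openin_ginv_image:
  assumes "openin (arrow_top G) V"
  shows "openin (arrow_top G) (ginv G ` V)"
proof -
  have "ginv G ` V = {a \<in> arrows G. ginv G a \<in> V}"
    using openin_subset[OF assms] ginv_closed ginv_ginv by (force simp: image_iff)
  then show ?thesis
    using openin_continuous_map_preimage[OF continuous_ginv assms] by simp
qed

end

section \<open>Source and range as open maps; open bisections via injectivity\<close>

context lch_etale_groupoid
begin

text \<open>A local homeomorphism is open: the image of \<open>V\<close> is the union of the images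
  of its pieces inside charts, and each of these is open because the chart has an open
  image.\<close>

lemma open_map_rng: "open_map (arrow_top G) (unit_top G) (rng G)"
  unfolding open_map_def
proof (intro allI impI)
  fix V assume V: "openin (arrow_top G) V"
  show "openin (unit_top G) (rng G ` V)"
  proof (subst openin_subopen, intro ballI)
    fix x assume "x \<in> rng G ` V"
    then obtain g where g: "g \<in> V" "x = rng G g" by blast
    with V have "g \<in> arrows G" using openin_subset by blast
    then obtain U where U: "openin (arrow_top G) U" "g \<in> U" "homeo_onto_open_units G (rng G) U"
      using etale by blast
    have "openin (subtopology (arrow_top G) U) (V \<inter> U)"
      using V by (rule openin_subtopology_Int)
    moreover have "open_map (subtopology (arrow_top G) U) (subtopology (unit_top G) (rng G ` U)) (rng G)"
      using U(3) homeomorphic_imp_open_map unfolding homeo_onto_open_units_def by blast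
    ultimately have "openin (subtopology (unit_top G) (rng G ` U)) (rng G ` (V \<inter> U))"
      by (simp add: open_map_def)
    then have "openin (unit_top G) (rng G ` (V \<inter> U))"
      using U(3) openin_trans_full unfolding homeo_onto_open_units_def by blast
    then show "\<exists>T. openin (unit_top G) T \<and> x \<in> T \<and> T \<subseteq> rng G ` V"
      using g U(2) by blast
  qed
qed

lemma openin_rng_image: "openin (arrow_top G) V \<Longrightarrow> openin (unit_top G) (rng G ` V)"
  using open_map_rng by (simp add: open_map_def)

lemma openin_src_image:
  assumes "openin (arrow_top G) V"
  shows "openin (unit_top G) (src G ` V)"
proof -
  have "src G ` V = rng G ` ginv G ` V"
    using openin_subset[OF assms] rng_ginv by (force simp: image_iff)
  then show ?thesis
    using assms openin_ginv_image openin_rng_image by simp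
qed

text \<open>As \<open>f\<close> is continuous and open on all arrows, so is its restriction to the
  open set \<open>U\<close>; only injectivity separates it from a homeomorphism onto an open
  set.\<close>

lemma homeo_onto_open_units_iff:
  assumes U: "openin (arrow_top G) U"
    and f: "continuous_map (arrow_top G) (unit_top G) f"
    and op: "\<And>V. openin (arrow_top G) V \<Longrightarrow> openin (unit_top G) (f ` V)"
  shows "homeo_onto_open_units G f U \<longleftrightarrow> inj_on f U"
proof
  have U': "U \<subseteq> arrows G" "f ` U \<subseteq> units G"
    using U op[OF U] openin_subset by fastforce+
  show "inj_on f U" if "homeo_onto_open_units G f U"
    using that U' homeomorphic_imp_injective_map unfolding homeo_onto_open_units_def
    by (fastforce simp: Int_absorb1)
  assume inj: "inj_on f U"
  have "homeomorphic_map (subtopology (arrow_top G) U) (subtopology (unit_top G) (f ` U)) f"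
  proof (rule bijective_open_imp_homeomorphic_map)
    show "continuous_map (subtopology (arrow_top G) U) (subtopology (unit_top G) (f ` U)) f"
      using f by (intro continuous_map_into_subtopology continuous_map_from_subtopology) auto
    show "open_map (subtopology (arrow_top G) U) (subtopology (unit_top G) (f ` U)) f"
      using U op by (auto simp: open_map_def openin_open_subtopology)
  qed (use U' inj in \<open>auto simp: Int_absorb1\<close>)
  then show "homeo_onto_open_units G f U"
    using op[OF U] by (simp add: homeo_onto_open_units_def)
qed

lemma open_bisection_iff:
  "open_bisection G U \<longleftrightarrow> openin (arrow_top G) U \<and> inj_on (src G) U \<and> inj_on (rng G) U"
  unfolding open_bisection_def
  using homeo_onto_open_units_iff continuous_map_src continuous_map_rng
    openin_rng_image openin_src_image by blast

lemma open_bisection_subset: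
  "open_bisection G A \<Longrightarrow> openin (arrow_top G) B \<Longrightarrow> B \<subseteq> A \<Longrightarrow> open_bisection G B"
  unfolding open_bisection_iff by (meson inj_on_subset)

lemma open_bisection_arrows: "open_bisection G A \<Longrightarrow> A \<subseteq> arrows G"
  using openin_subset by (auto simp: open_bisection_iff)

text \<open>The etale axiom gives a neighbourhood of \<open>g\<close> on which \<open>rng\<close> is
  injective. Inverting such a neighbourhood of \<open>ginv G g\<close> gives one of \<open>g\<close>
  on which \<open>src\<close> is injective; the intersection serves both maps.\<close>

lemma open_bisection_around:
  assumes "g \<in> arrows G"
  obtains A where "open_bisection G A" "g \<in> A"
proof -
  obtain U where U: "openin (arrow_top G) U" "g \<in> U" "homeo_onto_open_units G (rng G) U"
    using etale assms by blast
  obtain V where V: "openin (arrow_top G) V" "ginv G g \<in> V" "homeo_onto_open_units G (rng G) V"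
    using etale assms ginv_closed by blast
  have injU: "inj_on (rng G) U"
    using U homeo_onto_open_units_iff[OF U(1) continuous_map_rng openin_rng_image] by simp
  have injV: "inj_on (rng G) V"
    using V homeo_onto_open_units_iff[OF V(1) continuous_map_rng openin_rng_image] by simp
  have VA: "V \<subseteq> arrows G" using V(1) openin_subset by blast
  have "inj_on (src G) (ginv G ` V)"
  proof (rule inj_onI)
    fix x y assume "x \<in> ginv G ` V" "y \<in> ginv G ` V" "src G x = src G y"
    then obtain v w where "v \<in> V" "w \<in> V" "x = ginv G v" "y = ginv G w" by blast
    moreover from this have "rng G v = rng G w"
      using \<open>src G x = src G y\<close> src_ginv VA by (metis subsetD)
    ultimately show "x = y" using injV by (auto dest: inj_onD)
  qed
  moreover have "g \<in> ginv G ` V"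
    using V(2) ginv_ginv[OF assms] by force
  ultimately have "open_bisection G (U \<inter> ginv G ` V)" "g \<in> U \<inter> ginv G ` V"
    using U injU openin_ginv_image[OF V(1)] by (auto simp: open_bisection_iff intro: inj_on_subset)
  then show thesis using that by blast
qed

section \<open>Products of open bisections\<close>

definition bisection_prod :: "'a set \<Rightarrow> 'a set \<Rightarrow> 'a set" where
  "bisection_prod C A = {c \<odot> a | c a. c \<in> C \<and> a \<in> A \<and> src G c = rng G a}"

text \<open>An arrow \<open>g\<close> lies in \<open>C A\<close> iff \<open>src g \<in> src A\<close> and \<open>g \<sigma>(src g)\<inverse> \<in> C\<close>, where \<open>\<sigma>\<close> is the
  local inverse of \<open>src\<close> on \<open>A\<close>.  This makes \<open>C A\<close> an open set, as the preimage of \<open>C\<close>, without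
  using that multiplication is an open map.\<close>
lemma openin_bisection_prod:
  assumes C: "openin (arrow_top G) C" and A: "open_bisection G A"
  shows "openin (arrow_top G) (bisection_prod C A)"
proof -
  let ?X = "subtopology (arrow_top G) {g \<in> arrows G. src G g \<in> src G ` A}"
  have Ao: "openin (arrow_top G) A" and AA: "A \<subseteq> arrows G" and CA: "C \<subseteq> arrows G"
    using A C openin_subset by (auto simp: open_bisection_def)
  have "homeomorphic_map (subtopology (arrow_top G) A) (subtopology (unit_top G) (src G ` A)) (src G)"
    using A by (simp add: open_bisection_def homeo_onto_open_units_def)
  then obtain s where s: "homeomorphic_maps (subtopology (arrow_top G) A)
      (subtopology (unit_top G) (src G ` A)) (src G) s"
    using homeomorphic_map_maps by blast
  have sc: "continuous_map (subtopology (unit_top G) (src G ` A)) (arrow_top G) s"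
    using s continuous_map_into_fulltopology unfolding homeomorphic_maps_def by blast
  have ssrc: "s (src G a) = a" if "a \<in> A" for a
    using s that AA by (auto simp: homeomorphic_maps_def)
  have X: "openin (arrow_top G) {g \<in> arrows G. src G g \<in> src G ` A}"
    using openin_src_preimage[OF openin_topspace openin_src_image[OF Ao]] .
  have tX: "topspace ?X = {g \<in> arrows G. src G g \<in> src G ` A}" by auto
  have sX: "s (src G g) \<in> A \<and> src G (s (src G g)) = src G g" if "g \<in> topspace ?X" for g
    using that ssrc by auto
  have "continuous_map ?X (subtopology (unit_top G) (src G ` A)) (src G)"
    by (intro continuous_map_into_subtopology continuous_map_from_subtopology continuous_map_src) auto
  then have "continuous_map ?X (arrow_top G) (\<lambda>g. ginv G (s (src G g)))"
    using continuous_map_compose[OF continuous_map_compose[OF _ sc] continuous_ginv]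
    by (simp add: o_def)
  then have cont: "continuous_map ?X (arrow_top G) (\<lambda>g. g \<odot> ginv G (s (src G g)))"
  proof (rule continuous_map_mult[rotated])
    show "continuous_map ?X (arrow_top G) (\<lambda>g. g)"
      by (intro continuous_map_from_subtopology continuous_map_id[unfolded id_def])
    show "(g, ginv G (s (src G g))) \<in> composable G" if "g \<in> topspace ?X" for g
      using that sX[OF that] AA ginv_closed rng_ginv by (auto simp: composable_iff)
  qed
  have "bisection_prod C A = {g \<in> topspace ?X. g \<odot> ginv G (s (src G g)) \<in> C}" (is "_ = ?R")
  proof (intro subset_antisym subsetI)
    fix g assume "g \<in> bisection_prod C A"
    then obtain c a where g: "g = c \<odot> a" "c \<in> C" "a \<in> A" "src G c = rng G a"
      by (auto simp: bisection_prod_def)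
    then have ca: "(c, a) \<in> composable G" using CA AA composable_iff by blast
    then show "g \<in> ?R"
      using g ssrc mult_ginv_cancel[OF ca] mult_closed[OF ca] src_mult[OF ca] by auto
  next
    fix g assume g: "g \<in> ?R"
    \<comment> \<open>The only arrow of \<open>A\<close> with the source of \<open>g\<close>, hence
      the only possible right factor.\<close>
    define a where "a = s (src G g)"
    have a: "a \<in> A" "src G a = src G g" using sX g by (auto simp: a_def)
    have "g \<in> arrows G" "a \<in> arrows G" using g a AA by auto
    then have ga: "(g, ginv G a) \<in> composable G"
      using a composable_iff ginv_closed rng_ginv by simp
    have "g = (g \<odot> ginv G a) \<odot> a"
      using mult_ginv_cancel[OF ga] ginv_ginv \<open>a \<in> arrows G\<close> by simp
    moreover have "src G (g \<odot> ginv G a) = rng G a"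
      using src_mult[OF ga] src_ginv \<open>a \<in> arrows G\<close> by simp
    ultimately show "g \<in> bisection_prod C A"
      using g a unfolding bisection_prod_def a_def by blast
  qed
  then have "openin ?X (bisection_prod C A)"
    using openin_continuous_map_preimage[OF cont C] by simp
  then show ?thesis
    using X openin_trans_full by blast
qed

text \<open>Either endpoint of a product determines both factors: its source fixes \<open>a\<close>,
  whose range fixes \<open>c\<close>; its range fixes \<open>c\<close>, whose source fixes
  \<open>a\<close>.\<close>

lemma open_bisection_prod:
  assumes C: "open_bisection G C" and A: "open_bisection G A"
  shows "open_bisection G (bisection_prod C A)"
proof -
  have CA: "C \<subseteq> arrows G" and AA: "A \<subseteq> arrows G"
    using A C open_bisection_arrows by blast+
  have inj: "inj_on (src G) C" "inj_on (rng G) C" "inj_on (src G) A" "inj_on (rng G) A"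
    using A C by (auto simp: open_bisection_iff)
  have eq: "c = c' \<and> a = a'"
    if "c \<in> C" "a \<in> A" "src G c = rng G a" "c' \<in> C" "a' \<in> A" "src G c' = rng G a'"
      and "src G (c \<odot> a) = src G (c' \<odot> a') \<or> rng G (c \<odot> a) = rng G (c' \<odot> a')"
    for c a c' a'
  proof -
    have comp: "(c, a) \<in> composable G" "(c', a') \<in> composable G"
      using that CA AA composable_iff by blast+
    then have "src G a = src G a' \<or> rng G c = rng G c'"
      using that(7) src_mult rng_mult by simp
    then show ?thesis
      using that inj by (metis inj_onD)
  qed
  have "inj_on (src G) (bisection_prod C A)" "inj_on (rng G) (bisection_prod C A)"
    unfolding inj_on_def bisection_prod_def using eq by blast+
  then show ?thesis
    using openin_bisection_prod[OF _ A] C by (simp add: open_bisection_iff)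
qed

lemma src_image_bisection_prod:
  assumes "C \<subseteq> arrows G" "A \<subseteq> arrows G"
  shows "src G ` bisection_prod C A = {src G a | a. a \<in> A \<and> rng G a \<in> src G ` C}"
proof -
  have "src G (c \<odot> a) = src G a" if "c \<in> C" "a \<in> A" "src G c = rng G a" for c a
    using that assms composable_iff src_mult by blast
  then show ?thesis
    by (force simp: bisection_prod_def image_iff)
qed

lemma rng_image_bisection_prod:
  assumes "C \<subseteq> arrows G" "A \<subseteq> arrows G"
  shows "rng G ` bisection_prod C A \<subseteq> rng G ` C"
proof -
  have "rng G (c \<odot> a) = rng G c" if "c \<in> C" "a \<in> A" "src G c = rng G a" for c a
    using that assms composable_iff rng_mult by blast
  then show ?thesis
    by (force simp: bisection_prod_def image_iff)
qed

text \<open>On \<open>A\<close> the map \<open>src\<close> is a homeomorphism, so the arrows of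
  \<open>A\<close> that start in \<open>K\<close> form a compact set, and \<open>rng\<close> is
  continuous.\<close>

lemma compactin_rng_image:
  assumes A: "open_bisection G A" and K: "compactin (unit_top G) K" "K \<subseteq> src G ` A"
  shows "compactin (unit_top G) (rng G ` {a \<in> A. src G a \<in> K})"
proof -
  have "homeomorphic_map (subtopology (arrow_top G) A) (subtopology (unit_top G) (src G ` A)) (src G)"
    using A by (simp add: open_bisection_def homeo_onto_open_units_def)
  from homeomorphic_map_compactness[OF this, of "{a \<in> A. src G a \<in> K}"]
  have "compactin (arrow_top G) {a \<in> A. src G a \<in> K} \<longleftrightarrow>
      compactin (subtopology (unit_top G) (src G ` A)) (src G ` {a \<in> A. src G a \<in> K})"
    using open_bisection_arrows[OF A] by (auto simp: compactin_subtopology)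
  moreover have "src G ` {a \<in> A. src G a \<in> K} = K"
    using K(2) by auto
  ultimately have "compactin (arrow_top G) {a \<in> A. src G a \<in> K}"
    using K by (simp add: compactin_subtopology)
  then show ?thesis
    using image_compactin continuous_map_rng by blast
qed

end


subsection \<open>Comparison of compact sets with open sets\<close>

lemma disjoint_family_on_index_eq:
  "disjoint_family_on A I \<Longrightarrow> i \<in> I \<Longrightarrow> j \<in> I \<Longrightarrow> x \<in> A i \<Longrightarrow> x \<in> A j \<Longrightarrow> i = j"
  unfolding disjoint_family_on_def by blast

text \<open>The definition numbers its bisections by an initial segment of the naturals;
  transferring along a bijection admits any finite index set, in particular pairs of
  indices.\<close>

lemma compact_subequivI:
  assumes "finite I" "\<And>i. i \<in> I \<Longrightarrow> open_bisection G (A i)" "K \<subseteq> (\<Union>i\<in>I. src G ` A i)"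
    and "\<And>i. i \<in> I \<Longrightarrow> rng G ` A i \<subseteq> V" "disjoint_family_on (\<lambda>i. rng G ` A i) I"
  shows "compact_subequiv G K V"
proof -
  obtain h where h: "bij_betw h {..<card I} I"
    using ex_bij_betw_nat_finite[OF assms(1)] by (auto simp: atLeast0LessThan)
  then have hI: "h ` {..<card I} = I" and inj: "inj_on h {..<card I}"
    by (auto simp: bij_betw_def)
  have mem: "h i \<in> I" if "i < card I" for i
    using that hI by blast
  show ?thesis
    unfolding compact_subequiv_def
  proof (intro exI conjI allI impI)
    show "open_bisection G ((A \<circ> h) i)" "rng G ` (A \<circ> h) i \<subseteq> V" if "i < card I" for i
      using assms(2,4)[OF mem[OF that]] by simp_all
    show "K \<subseteq> (\<Union>i<card I. src G ` (A \<circ> h) i)"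
      using assms(3) arg_cong[OF hI, of "\<lambda>J. \<Union>i\<in>J. src G ` A i"] by simp
    show "disjoint_family_on (\<lambda>i. rng G ` (A \<circ> h) i) {..<card I}"
      using assms(5) inj mem unfolding disjoint_family_on_def inj_on_def o_def
      by (metis lessThan_iff)
  qed
qed

lemma compact_subequivE:
  assumes "compact_subequiv G K V"
  obtains n :: nat and A where "\<And>i. i < n \<Longrightarrow> open_bisection G (A i)"
    "K \<subseteq> (\<Union>i<n. src G ` A i)" "\<And>i. i < n \<Longrightarrow> rng G ` A i \<subseteq> V"
    "disjoint_family_on (\<lambda>i. rng G ` A i) {..<n}"
  using assms unfolding compact_subequiv_def by metis

lemma compact_subequiv_mono:
  "compact_subequiv G K V \<Longrightarrow> V \<subseteq> V' \<Longrightarrow> compact_subequiv G K V'"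
  unfolding compact_subequiv_def by (meson order_trans)

lemma compact_subequiv_antimono:
  "compact_subequiv G K V \<Longrightarrow> K' \<subseteq> K \<Longrightarrow> compact_subequiv G K' V"
  unfolding compact_subequiv_def by (meson order_trans)

text \<open>Witnesses for different \<open>i\<close> have ranges in disjoint sets
  \<open>V i\<close>, so pooling them keeps all ranges disjoint. The index set is a
  \<open>Sigma\<close> because the number of bisections varies with \<open>i\<close>.\<close>

lemma compact_subequiv_UN:
  assumes I: "finite I" and K: "\<And>i. i \<in> I \<Longrightarrow> compact_subequiv G (K i) (V i)"
    and disj: "disjoint_family_on V I"
  shows "compact_subequiv G (\<Union>i\<in>I. K i) (\<Union>i\<in>I. V i)"
proof -
  have "\<forall>i\<in>I. \<exists>(n::nat) A. (\<forall>j<n. open_bisection G (A j)) \<and> K i \<subseteq> (\<Union>j<n. src G ` A j) \<and>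
      (\<forall>j<n. rng G ` A j \<subseteq> V i) \<and> disjoint_family_on (\<lambda>j. rng G ` A j) {..<n}"
    using K unfolding compact_subequiv_def by simp
  then obtain n :: "_ \<Rightarrow> nat" and A where A: "\<And>i j. i \<in> I \<Longrightarrow> j < n i \<Longrightarrow> open_bisection G (A i j)"
      "\<And>i. i \<in> I \<Longrightarrow> K i \<subseteq> (\<Union>j<n i. src G ` A i j)"
      "\<And>i j. i \<in> I \<Longrightarrow> j < n i \<Longrightarrow> rng G ` A i j \<subseteq> V i"
      "\<And>i. i \<in> I \<Longrightarrow> disjoint_family_on (\<lambda>j. rng G ` A i j) {..<n i}"
    by metis
  show ?thesis
  proof (rule compact_subequivI[where I = "Sigma I (\<lambda>i. {..<n i})" and A = "\<lambda>(i, j). A i j"])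
    show "(\<Union>i\<in>I. K i) \<subseteq> (\<Union>p\<in>Sigma I (\<lambda>i. {..<n i}). src G ` (case p of (i, j) \<Rightarrow> A i j))"
      using A(2) by fastforce
    show "disjoint_family_on (\<lambda>p. rng G ` (case p of (i, j) \<Rightarrow> A i j)) (Sigma I (\<lambda>i. {..<n i}))"
      unfolding disjoint_family_on_def
    proof (intro ballI impI)
      fix p q assume p: "p \<in> Sigma I (\<lambda>i. {..<n i})" and q: "q \<in> Sigma I (\<lambda>i. {..<n i})" "p \<noteq> q"
      obtain i j i' j' where [simp]: "p = (i, j)" "q = (i', j')" by fastforce
      show "rng G ` (case p of (i, j) \<Rightarrow> A i j) \<inter> rng G ` (case q of (i, j) \<Rightarrow> A i j) = {}"
      proof (cases "i = i'")
        case True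
        then show ?thesis using p q A(4)[of i] by (auto simp: disjoint_family_on_def)
      next
        case False
        then have "V i \<inter> V i' = {}" using p q disj by (auto simp: disjoint_family_on_def)
        moreover have "rng G ` A i j \<subseteq> V i" "rng G ` A i' j' \<subseteq> V i'" using p q A(3) by auto
        ultimately show ?thesis by auto
      qed
    qed
    show "rng G ` (case p of (i, j) \<Rightarrow> A i j) \<subseteq> (\<Union>i\<in>I. V i)" if "p \<in> Sigma I (\<lambda>i. {..<n i})" for p
      using that A(3) by blast
  qed (use I A(1) in auto)
qed

lemma open_subequiv2E:
  assumes "open_subequiv2 G U V" "compactin (unit_top G) F" "F \<subseteq> U"
  obtains O1 O2 where "openin (unit_top G) O1" "openin (unit_top G) O2" "O1 \<noteq> {}" "O2 \<noteq> {}"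
    "O1 \<inter> O2 = {}" "O1 \<subseteq> V" "O2 \<subseteq> V" "compact_subequiv G F O1" "compact_subequiv G F O2"
  using assms(1)[unfolded open_subequiv2_def, rule_format, OF conjI[OF assms(2,3)]] by auto

text \<open>Each point of \<open>K\<close> has a compact neighbourhood relative to \<open>K\<close>
  inside some \<open>U i\<close>; finitely many cover \<open>K\<close> and are grouped by
  \<open>i\<close>. This cuts a compact set into compact pieces, each over one bisection.\<close>

lemma compact_shrink_cover:
  assumes X: "Hausdorff_space X" and K: "compactin X K" and I: "finite I"
    and U: "\<And>i. i \<in> I \<Longrightarrow> openin X (U i)" and cov: "K \<subseteq> (\<Union>i\<in>I. U i)"
  obtains L where "\<And>i. i \<in> I \<Longrightarrow> compactin X (L i)" "\<And>i. i \<in> I \<Longrightarrow> L i \<subseteq> U i" "K = (\<Union>i\<in>I. L i)"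
proof -
  \<comment> \<open>As a compact Hausdorff space, \<open>K\<close> with its subspace topology has a
    base of compact neighbourhoods.\<close>
  let ?Y = "subtopology X K"
  have "Hausdorff_space ?Y" using X by (rule Hausdorff_space_subtopology)
  moreover have "compact_space ?Y" using K by (simp add: compactin_subspace)
  ultimately have nb: "neighbourhood_base_of (compactin ?Y) ?Y"
    using compact_imp_locally_compact_space locally_compact_space_neighbourhood_base by blast
  have "\<exists>i C N. i \<in> I \<and> openin ?Y N \<and> compactin ?Y C \<and> x \<in> N \<and> N \<subseteq> C \<and> C \<subseteq> U i" if x: "x \<in> K" for x
  proof -
    obtain i where i: "i \<in> I" "x \<in> U i" using cov x by blast
    then have "openin ?Y (U i \<inter> K)" "x \<in> U i \<inter> K" using U x by (auto intro: openin_subtopology_Int)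
    then obtain N C where "openin ?Y N" "compactin ?Y C" "x \<in> N" "N \<subseteq> C" "C \<subseteq> U i \<inter> K"
      using nb[unfolded neighbourhood_base_of, rule_format, of "U i \<inter> K" x] by auto
    then show ?thesis using i by blast
  qed
  then obtain i C N where iCN: "\<And>x. x \<in> K \<Longrightarrow> i x \<in> I \<and> openin ?Y (N x) \<and> compactin ?Y (C x) \<and>
      x \<in> N x \<and> N x \<subseteq> C x \<and> C x \<subseteq> U (i x)"
    by metis
  have "compactin ?Y K" using K by (simp add: compactin_subtopology)
  moreover have "K \<subseteq> \<Union>(N ` K)" using iCN by blast
  ultimately obtain \<F> where "finite \<F>" "\<F> \<subseteq> N ` K" "K \<subseteq> \<Union>\<F>"
    using compactinD[of ?Y K "N ` K"] iCN by blast
  then obtain F where F: "finite F" "F \<subseteq> K" "K \<subseteq> (\<Union>x\<in>F. N x)"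
    using finite_subset_image by metis
  \<comment> \<open>An index that no point of \<open>F\<close> selects receives the empty set, which
    is compact.\<close>
  define L where "L j = (\<Union>x\<in>{x \<in> F. i x = j}. C x)" for j
  have CX: "compactin X (C x)" "C x \<subseteq> K" if "x \<in> F" for x
    using iCN F that compactin_subtopology by blast+
  show thesis
  proof
    show "compactin X (L j)" if "j \<in> I" for j
      unfolding L_def using F CX by (intro compactin_Union) auto
    show "L j \<subseteq> U j" if "j \<in> I" for j
      unfolding L_def using F iCN by blast
    have "K \<subseteq> (\<Union>x\<in>F. C x)" using F iCN by blast
    also have "\<dots> \<subseteq> (\<Union>j\<in>I. L j)"
      unfolding L_def using F iCN by blast
    finally show "K = (\<Union>j\<in>I. L j)"
      unfolding L_def using CX by blast
  qed
qed

section \<open>Moving compact sets along bisections\<close>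

context lch_etale_groupoid
begin

lemma Hausdorff_unit_top: "Hausdorff_space (unit_top G)"
  unfolding unit_top_def using Hausdorff by (rule Hausdorff_space_subtopology)

text \<open>\<open>K\<close> travels first along \<open>A\<close> and then along the bisections
  \<open>C i\<close> that place its image in \<open>V\<close>. The products have ranges inside those
  of the \<open>C i\<close>, so disjointness persists.\<close>

lemma compact_subequiv_bisection:
  assumes A: "open_bisection G A" and K: "K \<subseteq> src G ` A"
    and sub: "compact_subequiv G (rng G ` {a \<in> A. src G a \<in> K}) V"
  shows "compact_subequiv G K V"
proof -
  obtain n :: nat and C :: "nat \<Rightarrow> 'a set" where C: "\<And>i. i < n \<Longrightarrow> open_bisection G (C i)"
    "rng G ` {a \<in> A. src G a \<in> K} \<subseteq> (\<Union>i<n. src G ` C i)" "\<And>i. i < n \<Longrightarrow> rng G ` C i \<subseteq> V"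
    "disjoint_family_on (\<lambda>i. rng G ` C i) {..<n}"
    using sub by (rule compact_subequivE) blast
  have AA: "A \<subseteq> arrows G" and CA: "\<And>i. i < n \<Longrightarrow> C i \<subseteq> arrows G"
    using A C(1) open_bisection_arrows by blast+
  show ?thesis
  proof (rule compact_subequivI[where I = "{..<n}" and A = "\<lambda>i. bisection_prod (C i) A"])
    show "K \<subseteq> (\<Union>i<n. src G ` bisection_prod (C i) A)"
    proof
      fix x assume "x \<in> K"
      then obtain a where a: "a \<in> A" "x = src G a" using K by blast
      with \<open>x \<in> K\<close> C(2) obtain i where "i < n" "rng G a \<in> src G ` C i" by blast
      with a show "x \<in> (\<Union>i<n. src G ` bisection_prod (C i) A)"
        using src_image_bisection_prod[OF CA AA] by blast
    qed
    show "disjoint_family_on (\<lambda>i. rng G ` bisection_prod (C i) A) {..<n}"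
      unfolding disjoint_family_on_def
    proof (intro ballI impI)
      fix i j assume "i \<in> {..<n}" "j \<in> {..<n}" "i \<noteq> j"
      then show "rng G ` bisection_prod (C i) A \<inter> rng G ` bisection_prod (C j) A = {}"
        using disjoint_family_onD[OF C(4), of i j]
          rng_image_bisection_prod[OF CA[of i] AA] rng_image_bisection_prod[OF CA[of j] AA] by simp blast
    qed
    show "rng G ` bisection_prod (C i) A \<subseteq> V" if "i \<in> {..<n}" for i
      using that C(3) rng_image_bisection_prod[OF CA AA] by blast
  qed (use A C open_bisection_prod in auto)
qed

text \<open>Transitivity in a form where \<open>L\<close> is fixed before \<open>W\<close>, so that
  one compact set inside \<open>V\<close> serves every later target. It is the union of the pieces
  of \<open>K\<close>, each moved into \<open>V\<close> along its own bisection.\<close>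

lemma compact_subequiv_transport:
  assumes K: "compactin (unit_top G) K" and sub: "compact_subequiv G K V"
  obtains L where "compactin (unit_top G) L" "L \<subseteq> V"
    "\<And>W. compact_subequiv G L W \<Longrightarrow> compact_subequiv G K W"
proof -
  obtain n :: nat and A :: "nat \<Rightarrow> 'a set" where A: "\<And>i. i < n \<Longrightarrow> open_bisection G (A i)"
    "K \<subseteq> (\<Union>i<n. src G ` A i)" "\<And>i. i < n \<Longrightarrow> rng G ` A i \<subseteq> V"
    "disjoint_family_on (\<lambda>i. rng G ` A i) {..<n}"
    using sub by (rule compact_subequivE) blast
  have "\<And>i. i \<in> {..<n} \<Longrightarrow> openin (unit_top G) (src G ` A i)"
    using A(1) openin_src_image by (simp add: open_bisection_iff)
  then obtain K' where K': "\<And>i. i \<in> {..<n} \<Longrightarrow> compactin (unit_top G) (K' i)"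
      "\<And>i. i \<in> {..<n} \<Longrightarrow> K' i \<subseteq> src G ` A i" "K = (\<Union>i<n. K' i)"
    using compact_shrink_cover[OF Hausdorff_unit_top K finite_lessThan _ A(2)] by metis
  define L where "L i = rng G ` {a \<in> A i. src G a \<in> K' i}" for i
  show thesis
  proof
    have "compactin (unit_top G) (L i)" if "i < n" for i
      unfolding L_def using that A(1) K'(1,2) compactin_rng_image by blast
    then show "compactin (unit_top G) (\<Union>i<n. L i)"
      by (intro compactin_Union) auto
    show "(\<Union>i<n. L i) \<subseteq> V"
      unfolding L_def using A(3) by blast
    fix W assume "compact_subequiv G (\<Union>i<n. L i) W"
    then obtain m :: nat and C :: "nat \<Rightarrow> 'a set" where C: "\<And>j. j < m \<Longrightarrow> open_bisection G (C j)"
      "(\<Union>i<n. L i) \<subseteq> (\<Union>j<m. src G ` C j)" "\<And>j. j < m \<Longrightarrow> rng G ` C j \<subseteq> W"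
      "disjoint_family_on (\<lambda>j. rng G ` C j) {..<m}"
      by (rule compact_subequivE) blast
    define D where "D i j = {c \<in> C j. src G c \<in> rng G ` A i}" for i j
    have D: "open_bisection G (D i j)" if "i < n" "j < m" for i j
      unfolding D_def using A(1)[OF that(1)] C(1)[OF that(2)]
      by (intro open_bisection_subset[OF C(1)[OF that(2)]] openin_src_preimage openin_rng_image)
         (auto simp: open_bisection_iff)
    \<comment> \<open>Equal ranges put both arrows in the same \<open>C j\<close>; there
      \<open>rng\<close> is injective, so they coincide, and their common source lies in the range
      of only one \<open>A i\<close>.\<close>
    have dd: "i = i' \<and> j = j'" if "c \<in> D i j" "c' \<in> D i' j'" "rng G c = rng G c'"
        "i < n" "i' < n" "j < m" "j' < m" for i i' j j' c c'
    proof -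
      have c: "c \<in> C j" "src G c \<in> rng G ` A i" "c' \<in> C j'" "src G c' \<in> rng G ` A i'"
        using that by (auto simp: D_def)
      have "rng G c \<in> rng G ` C j" "rng G c \<in> rng G ` C j'"
        using c(1,3) that(3) by (metis imageI)+
      then have "j = j'"
        using disjoint_family_on_index_eq[OF C(4)] that by blast
      moreover from this have "c = c'"
        using c that C(1)[of j] by (auto simp: open_bisection_iff dest: inj_onD)
      then have "i = i'"
        using disjoint_family_on_index_eq[OF A(4)] c that by blast
      ultimately show ?thesis by blast
    qed
    have "compact_subequiv G (\<Union>i<n. K' i) (\<Union>i<n. \<Union>j<m. rng G ` D i j)"
    proof (rule compact_subequiv_UN)
      fix i assume i: "i \<in> {..<n}"
      show "compact_subequiv G (K' i) (\<Union>j<m. rng G ` D i j)"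
      proof (rule compact_subequiv_bisection[where A = "A i"])
        show "compact_subequiv G (rng G ` {a \<in> A i. src G a \<in> K' i}) (\<Union>j<m. rng G ` D i j)"
        proof (rule compact_subequivI[where I = "{..<m}" and A = "D i"])
          have "x \<in> (\<Union>j<m. src G ` D i j)" if x: "x \<in> L i" for x
          proof -
            obtain j c where "j < m" "c \<in> C j" "x = src G c" using x C(2) i by blast
            moreover have "x \<in> rng G ` A i" using x by (auto simp: L_def)
            ultimately show ?thesis unfolding D_def by blast
          qed
          then show "rng G ` {a \<in> A i. src G a \<in> K' i} \<subseteq> (\<Union>j<m. src G ` D i j)"
            unfolding L_def by blast
          show "disjoint_family_on (\<lambda>j. rng G ` D i j) {..<m}"
            unfolding disjoint_family_on_def using i dd by blast
        qed (use i D in auto)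
      qed (use i A K' in auto)
    next
      show "disjoint_family_on (\<lambda>i. \<Union>j<m. rng G ` D i j) {..<n}"
        unfolding disjoint_family_on_def using dd by blast
    qed simp
    then show "compact_subequiv G K W"
      unfolding K'(3)
    proof (rule compact_subequiv_mono)
      show "(\<Union>i<n. \<Union>j<m. rng G ` D i j) \<subseteq> W"
        unfolding D_def using C(3) by blast
    qed
  qed
qed

subsection \<open>Pure infiniteness and paradoxical comparison\<close>

text \<open>By induction with \<open>V\<close> varying: two disjoint open parts of \<open>V\<close>
  each receive \<open>K\<close>. One is kept as a copy, and the other replaces \<open>V\<close> in
  the search for the remaining copies.\<close>

lemma paradoxical_comparison_disjoint_copies:
  assumes par: "paradoxical_comparison G" and K: "compactin (unit_top G) K"
    and "openin (unit_top G) V" "V \<noteq> {}" "compact_subequiv G K V"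
  shows "\<exists>W. (\<forall>i<n::nat. W i \<subseteq> V \<and> compact_subequiv G K (W i)) \<and> disjoint_family_on W {..<n}"
  using assms(3-)
proof (induction n arbitrary: V)
  case 0
  show ?case by (simp add: disjoint_family_on_def)
next
  case (Suc n)
  \<comment> \<open>\<open>K\<close> may lie outside \<open>V\<close>, whereas paradoxical
    comparison of \<open>V\<close> with itself speaks of compact subsets of \<open>V\<close>;
    \<open>L\<close> stands in for \<open>K\<close>.\<close>
  obtain L where L: "compactin (unit_top G) L" "L \<subseteq> V"
      "\<And>W. compact_subequiv G L W \<Longrightarrow> compact_subequiv G K W"
    using compact_subequiv_transport[OF K Suc.prems(3)] by metis
  have "open_subequiv2 G V V"
    using par Suc.prems by (simp add: paradoxical_comparison_def)
  then obtain O1 O2 where O: "openin (unit_top G) O1" "O1 \<noteq> {}" "O1 \<inter> O2 = {}" "O1 \<subseteq> V" "O2 \<subseteq> V"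
      "compact_subequiv G L O1" "compact_subequiv G L O2"
    using L(1,2) by (rule open_subequiv2E)
  obtain W where W: "\<And>i. i < n \<Longrightarrow> W i \<subseteq> O1" "\<And>i. i < n \<Longrightarrow> compact_subequiv G K (W i)"
      "disjoint_family_on W {..<n}"
    using Suc.IH[OF O(1,2) L(3)[OF O(6)]] by blast
  have "disjoint_family_on (W(n := O2)) {..<Suc n}"
    unfolding disjoint_family_on_def
  proof (intro ballI impI)
    fix i j assume ij: "i \<in> {..<Suc n}" "j \<in> {..<Suc n}" "i \<noteq> j"
    then consider "i < n" "j < n" | "i = n" "j < n" | "i < n" "j = n" by force
    then show "(W(n := O2)) i \<inter> (W(n := O2)) j = {}"
      using ij W(1)[of i] W(1)[of j] W(3) O(3) by cases (auto simp: disjoint_family_on_def)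
  qed
  moreover have "(W(n := O2)) i \<subseteq> V \<and> compact_subequiv G K ((W(n := O2)) i)" if "i < Suc n" for i
    using that W(1,2)[of i] O(4,5) L(3)[OF O(7)] by (cases "i = n") auto
  ultimately show ?case by blast
qed

text \<open>An arrow from \<open>V\<close> to a point of \<open>K\<close> inverts to one from that
  point into \<open>V\<close>. A bisection around the inverse, cut down to arrows ending in
  \<open>V\<close>, has a source set that is an open neighbourhood of the point.\<close>

lemma compact_cover_by_bisections:
  assumes K: "compactin (unit_top G) K" and V: "openin (unit_top G) V"
    and KV: "K \<subseteq> rng G ` arrows_from G V"
  obtains \<B> where "finite \<B>" "\<And>B. B \<in> \<B> \<Longrightarrow> open_bisection G B \<and> rng G ` B \<subseteq> V"
    "K \<subseteq> (\<Union>B\<in>\<B>. src G ` B)"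
proof -
  let ?\<U> = "{B. open_bisection G B \<and> rng G ` B \<subseteq> V}"
  have "K \<subseteq> \<Union>((\<lambda>B. src G ` B) ` ?\<U>)"
  proof
    fix x assume "x \<in> K"
    then obtain h where h: "h \<in> arrows G" "src G h \<in> V" "x = rng G h"
      using KV by (auto simp: arrows_from_def)
    define g where "g = ginv G h"
    have g: "g \<in> arrows G" "rng G g \<in> V" "x = src G g"
      using h ginv_closed rng_ginv src_ginv by (auto simp: g_def)
    obtain A where A: "open_bisection G A" "g \<in> A"
      using open_bisection_around[OF g(1)] by blast
    have "open_bisection G {a \<in> A. rng G a \<in> V}"
      using A V by (intro open_bisection_subset[OF A(1)] openin_rng_preimage) (auto simp: open_bisection_iff)
    then have "{a \<in> A. rng G a \<in> V} \<in> ?\<U>" "x \<in> src G ` {a \<in> A. rng G a \<in> V}"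
      using A(2) g by auto
    then show "x \<in> \<Union>((\<lambda>B. src G ` B) ` ?\<U>)" by blast
  qed
  moreover have "\<And>U. U \<in> (\<lambda>B. src G ` B) ` ?\<U> \<Longrightarrow> openin (unit_top G) U"
    using openin_src_image by (auto simp: open_bisection_iff)
  ultimately have "\<exists>\<F>. finite \<F> \<and> \<F> \<subseteq> (\<lambda>B. src G ` B) ` ?\<U> \<and> K \<subseteq> \<Union>\<F>"
    by (rule compactinD[OF K, rotated])
  then obtain \<F> where \<F>: "finite \<F>" "\<F> \<subseteq> (\<lambda>B. src G ` B) ` ?\<U>" "K \<subseteq> \<Union>\<F>"
    by (elim exE conjE)
  obtain \<B> where "\<B> \<subseteq> ?\<U>" "finite \<B>" "\<F> = (\<lambda>B. src G ` B) ` \<B>"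
    using finite_subset_image[OF \<F>(1,2)] by (elim exE conjE)
  then show thesis
    using that[of \<B>] \<F>(3) by auto
qed

text \<open>Both sets are taken to be \<open>W\<close>; the inclusion required holds because each
  unit is an arrow from itself to itself.\<close>

lemma purely_infinite_imp_paradoxical_comparison:
  "purely_infinite G \<Longrightarrow> paradoxical_comparison G"
  unfolding purely_infinite_def paradoxical_comparison_def
  using subset_rng_arrows_from openin_subset topspace_unit_top by metis

lemma purely_infinite_imp_weakly_purely_infinite:
  "purely_infinite G \<Longrightarrow> weakly_purely_infinite G"
  unfolding purely_infinite_def weakly_purely_infinite_def open_subequiv_def
  using compact_subequiv_mono open_subequiv2E by metis

text \<open>Finitely many bisections move the pieces of \<open>F\<close> onto a compact set
  \<open>L\<close> inside \<open>O2\<close>, possibly with overlaps. Non-empty open sets that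
  receive \<open>L\<close> also receive \<open>F\<close>, and paradoxical comparison of
  \<open>O2\<close> with itself supplies two disjoint ones.\<close>

lemma paradoxical_comparison_imp_purely_infinite:
  assumes par: "paradoxical_comparison G"
  shows "purely_infinite G"
  unfolding purely_infinite_def open_subequiv2_def
proof (intro allI impI, elim conjE)
  fix O1 O2 F
  assume O2: "openin (unit_top G) O2" "O2 \<noteq> {}" and sub: "O1 \<subseteq> rng G ` arrows_from G O2"
    and F: "compactin (unit_top G) F" "F \<subseteq> O1"
  have "F \<subseteq> rng G ` arrows_from G O2" using F sub by blast
  then obtain \<B> where \<B>: "finite \<B>" "\<And>B. B \<in> \<B> \<Longrightarrow> open_bisection G B \<and> rng G ` B \<subseteq> O2"
      "F \<subseteq> (\<Union>B\<in>\<B>. src G ` B)"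
    using compact_cover_by_bisections[OF F(1) O2(1)] by metis
  then obtain K where K: "\<And>B. B \<in> \<B> \<Longrightarrow> compactin (unit_top G) (K B)"
      "\<And>B. B \<in> \<B> \<Longrightarrow> K B \<subseteq> src G ` B" "F = (\<Union>B\<in>\<B>. K B)"
    using compact_shrink_cover[OF Hausdorff_unit_top F(1) \<B>(1), of "\<lambda>B. src G ` B"] openin_src_image
    by (metis open_bisection_iff)
  define L where "L = (\<Union>B\<in>\<B>. rng G ` {a \<in> B. src G a \<in> K B})"
  have "compactin (unit_top G) (rng G ` {a \<in> B. src G a \<in> K B})" if "B \<in> \<B>" for B
    using that \<B>(2) K(1,2) by (simp add: compactin_rng_image)
  then have L: "compactin (unit_top G) L"
    unfolding L_def using \<B>(1) by (intro compactin_Union) auto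
  have "L \<subseteq> O2" unfolding L_def using \<B> by blast
  obtain h where h: "bij_betw h \<B> {..<card \<B>}"
    using ex_bij_betw_finite_nat[OF \<B>(1)] by (auto simp: atLeast0LessThan)
  \<comment> \<open>\<open>V\<close> contains \<open>card \<B>\<close> disjoint sets that each
    receive all of \<open>L\<close>. The piece \<open>K B\<close> goes along \<open>B\<close> into
    \<open>L\<close> and on into the set reserved for \<open>B\<close>, which pulls apart pieces
    that overlap in \<open>L\<close>.\<close>
  have F_sub: "compact_subequiv G F V"
    if V: "openin (unit_top G) V" "V \<noteq> {}" "compact_subequiv G L V" for V
  proof -
    obtain W where W: "\<And>i. i < card \<B> \<Longrightarrow> W i \<subseteq> V" "\<And>i. i < card \<B> \<Longrightarrow> compact_subequiv G L (W i)"
        "disjoint_family_on W {..<card \<B>}"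
      using paradoxical_comparison_disjoint_copies[OF par L V] by metis
    have hB: "h B < card \<B>" if "B \<in> \<B>" for B
      using h that by (auto simp: bij_betw_def)
    have "compact_subequiv G (\<Union>B\<in>\<B>. K B) (\<Union>B\<in>\<B>. W (h B))"
    proof (rule compact_subequiv_UN[OF \<B>(1)])
      fix B assume B: "B \<in> \<B>"
      have "compact_subequiv G (rng G ` {a \<in> B. src G a \<in> K B}) (W (h B))"
        using W(2)[OF hB[OF B]] by (rule compact_subequiv_antimono) (use B in \<open>auto simp: L_def\<close>)
      then show "compact_subequiv G (K B) (W (h B))"
        by (rule compact_subequiv_bisection[OF conjunct1[OF \<B>(2)[OF B]] K(2)[OF B]])
    next
      show "disjoint_family_on (\<lambda>B. W (h B)) \<B>"
        unfolding disjoint_family_on_def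
      proof (intro ballI impI)
        fix B C assume BC: "B \<in> \<B>" "C \<in> \<B>" "B \<noteq> C"
        then have "h B \<noteq> h C" using h by (auto simp: bij_betw_def inj_on_def)
        then show "W (h B) \<inter> W (h C) = {}"
          using disjoint_family_onD[OF W(3)] hB BC by simp
      qed
    qed
    then show ?thesis
      unfolding K(3) by (rule compact_subequiv_mono) (use W(1) hB in blast)
  qed
  have "open_subequiv2 G O2 O2"
    using par O2 by (simp add: paradoxical_comparison_def)
  then obtain V1 V2 where V: "openin (unit_top G) V1" "openin (unit_top G) V2" "V1 \<noteq> {}" "V2 \<noteq> {}"
      "V1 \<inter> V2 = {}" "V1 \<subseteq> O2" "V2 \<subseteq> O2" "compact_subequiv G L V1" "compact_subequiv G L V2"
    using L \<open>L \<subseteq> O2\<close> by (rule open_subequiv2E)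
  then show "\<exists>V1 V2. openin (unit_top G) V1 \<and> openin (unit_top G) V2 \<and> V1 \<noteq> {} \<and> V2 \<noteq> {} \<and>
      V1 \<inter> V2 = {} \<and> V1 \<subseteq> O2 \<and> V2 \<subseteq> O2 \<and> compact_subequiv G F V1 \<and> compact_subequiv G F V2"
    using V F_sub[OF V(1,3,8)] F_sub[OF V(2,4,9)] by blast
qed

subsection \<open>Comparison and invariant measures\<close>

lemma disjoint_open_subsets:
  assumes "x \<in> V" "y \<in> V" "x \<noteq> y" "openin (unit_top G) V"
  obtains V1 V2 where "openin (unit_top G) V1" "openin (unit_top G) V2" "V1 \<noteq> {}" "V2 \<noteq> {}"
    "V1 \<inter> V2 = {}" "V1 \<subseteq> V" "V2 \<subseteq> V"
proof -
  have "x \<in> topspace (unit_top G)" "y \<in> topspace (unit_top G)"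
    using assms openin_subset by blast+
  then obtain U1 U2 where U: "openin (unit_top G) U1" "openin (unit_top G) U2" "x \<in> U1" "y \<in> U2"
      "disjnt U1 U2"
    using Hausdorff_unit_top assms(3) unfolding Hausdorff_space_def by metis
  show thesis
  proof
    show "openin (unit_top G) (U1 \<inter> V)" "openin (unit_top G) (U2 \<inter> V)"
      using U assms(4) by (auto intro: openin_Int)
  qed (use U assms in \<open>auto simp: disjnt_iff\<close>)
qed

text \<open>Disjoint ranges inside one point allow a single non-empty bisection, and injectivity of
  \<open>rng\<close> leaves it a single arrow, hence a single source.\<close>

lemma compact_subequiv_singleton:
  assumes "compact_subequiv G {a, b} {x}"
  shows "a = b"
proof -
  obtain n :: nat and A :: "nat \<Rightarrow> 'a set" where A: "\<And>i. i < n \<Longrightarrow> open_bisection G (A i)"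
    "{a, b} \<subseteq> (\<Union>i<n. src G ` A i)" "\<And>i. i < n \<Longrightarrow> rng G ` A i \<subseteq> {x}"
    "disjoint_family_on (\<lambda>i. rng G ` A i) {..<n}"
    using assms by (rule compact_subequivE) blast
  obtain i g where i: "i < n" "g \<in> A i" "a = src G g" using A(2) by blast
  obtain j h where j: "j < n" "h \<in> A j" "b = src G h" using A(2) by blast
  have "rng G g = x" "rng G h = x" using i j A(3) by blast+
  then have "rng G ` A i \<inter> rng G ` A j \<noteq> {}" using i j by blast
  then have "i = j" using A(4) i j by (auto simp: disjoint_family_on_def)
  then have "g = h"
    using A(1)[OF i(1)] i j \<open>rng G g = x\<close> \<open>rng G h = x\<close> by (auto simp: open_bisection_iff dest: inj_onD)
  then show ?thesis using i j by simp
qed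

text \<open>Without invariant measures the measure condition in comparison is vacuous, so every open
  set lies below every non-empty open set. It remains to find two disjoint non-empty open subsets of
  \<open>O2\<close>.\<close>

lemma comparison_imp_purely_infinite:
  assumes inf: "infinite (units G)"
    and comp: "groupoid_comparison G" and M: "invariant_measures G = {}"
  shows "purely_infinite G"
  unfolding purely_infinite_def
proof (intro allI impI, elim conjE)
  fix O1 O2 assume O: "openin (unit_top G) O1" "openin (unit_top G) O2" "O2 \<noteq> {}"
  have all: "open_subequiv G U V" if "openin (unit_top G) U" "openin (unit_top G) V" "V \<noteq> {}" for U V
    using that comp M unfolding groupoid_comparison_def by blast
  obtain a b where ab: "a \<in> units G" "b \<in> units G" "a \<noteq> b"
    using inf by (metis infinite_arbitrarily_large card_2_iff insert_subset)
  \<comment> \<open>If \<open>O2\<close> were a single point, the two distinct units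
    \<open>a\<close> and \<open>b\<close> would be placed below it.\<close>
  have "\<exists>x y. x \<in> O2 \<and> y \<in> O2 \<and> x \<noteq> y"
  proof (rule ccontr)
    assume "\<not> ?thesis"
    then obtain x where "O2 = {x}" using O(3) by blast
    moreover have "compactin (unit_top G) {a, b}"
      using ab by (intro finite_imp_compactin) auto
    moreover have "openin (unit_top G) (units G)"
      using openin_topspace[of "unit_top G"] by simp
    ultimately have "compact_subequiv G {a, b} {x}"
      using all[of "units G" O2] O ab unfolding open_subequiv_def by simp
    then show False using compact_subequiv_singleton ab by blast
  qed
  then obtain V1 V2 where V: "openin (unit_top G) V1" "openin (unit_top G) V2" "V1 \<noteq> {}" "V2 \<noteq> {}"
    "V1 \<inter> V2 = {}" "V1 \<subseteq> O2" "V2 \<subseteq> O2"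
    using disjoint_open_subsets O(2) by metis
  then have "open_subequiv G O1 V1" "open_subequiv G O1 V2"
    using all O(1) by blast+
  then show "open_subequiv2 G O1 O2"
    using V unfolding open_subequiv2_def open_subequiv_def by meson
qed

text \<open>Inner regularity reduces the claim to compact \<open>K\<close>. For these, invariance
  trades the sources covering \<open>K\<close> for disjoint ranges in \<open>V\<close> of the same
  measures.\<close>

lemma invariant_measure_mono:
  assumes mu: "\<mu> \<in> invariant_measures G"
    and U: "openin (unit_top G) U" and V: "openin (unit_top G) V" and sub: "open_subequiv G U V"
  shows "emeasure \<mu> U \<le> emeasure \<mu> V"
proof -
  have reg: "regular_borel_prob_measure (unit_top G) \<mu>"
    and inv: "\<And>B. open_bisection G B \<Longrightarrow> emeasure \<mu> (rng G ` B) = emeasure \<mu> (src G ` B)"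
    using mu by (auto simp: invariant_measures_def)
  have borel: "W \<in> sets \<mu>" "W \<in> borel_sets_of (unit_top G)" if "openin (unit_top G) W" for W
    using reg that unfolding regular_borel_prob_measure_def borel_sets_of_def
    by (auto intro: sigma_sets.Basic)
  have "emeasure \<mu> K \<le> emeasure \<mu> V" if K: "compactin (unit_top G) K" "K \<subseteq> U" for K
  proof -
    have "compact_subequiv G K V" using sub K unfolding open_subequiv_def by blast
    then obtain n :: nat and A :: "nat \<Rightarrow> 'a set" where A: "\<And>i. i < n \<Longrightarrow> open_bisection G (A i)"
      "K \<subseteq> (\<Union>i<n. src G ` A i)" "\<And>i. i < n \<Longrightarrow> rng G ` A i \<subseteq> V"
      "disjoint_family_on (\<lambda>i. rng G ` A i) {..<n}"
      by (rule compact_subequivE) blast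
    have sA: "src G ` A i \<in> sets \<mu>" and rA: "rng G ` A i \<in> sets \<mu>" if "i < n" for i
      using A(1)[OF that] borel openin_src_image openin_rng_image by (auto simp: open_bisection_iff)
    have "emeasure \<mu> K \<le> emeasure \<mu> (\<Union>i<n. src G ` A i)"
      using A(2) sA by (intro emeasure_mono) auto
    also have "\<dots> \<le> (\<Sum>i<n. emeasure \<mu> (src G ` A i))"
      using sA by (intro emeasure_subadditive_finite) auto
    also have "\<dots> = (\<Sum>i<n. emeasure \<mu> (rng G ` A i))"
      using A(1) inv by simp
    also have "\<dots> = emeasure \<mu> (\<Union>i<n. rng G ` A i)"
      using A(4) rA by (intro sum_emeasure) auto
    also have "\<dots> \<le> emeasure \<mu> V"
      using A(3) borel[OF V] by (intro emeasure_mono) auto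
    finally show ?thesis .
  qed
  moreover have "emeasure \<mu> U = (SUP K \<in> {K. compactin (unit_top G) K \<and> K \<subseteq> U}. emeasure \<mu> K)"
    using reg borel(2)[OF U] unfolding regular_borel_prob_measure_def by blast
  ultimately show ?thesis
    by (auto intro: SUP_least)
qed

text \<open>The units not reached from \<open>V\<close> form an invariant set, closed since
  \<open>rng\<close> is open. It misses \<open>V\<close>, which reaches itself, so minimality leaves
  it empty.\<close>

lemma minimal_rng_arrows_from:
  assumes min: "minimal G" and V: "openin (unit_top G) V" "V \<noteq> {}"
  shows "rng G ` arrows_from G V = units G"
proof -
  define D where "D = units G - rng G ` arrows_from G V"
  have "openin (arrow_top G) (arrows_from G V)"
    unfolding arrows_from_def using V(1) by (intro openin_src_preimage) auto
  then have "openin (unit_top G) (rng G ` arrows_from G V)" by (rule openin_rng_image)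
  then have "closedin (unit_top G) D"
    unfolding D_def by (metis closedin_diff closedin_topspace topspace_unit_top)
  moreover have "invariant G D"
    unfolding invariant_def
  proof
    show DU: "D \<subseteq> units G" by (auto simp: D_def)
    show "rng G ` arrows_from G D = D"
    proof (intro subset_antisym subset_rng_arrows_from DU)
      show "rng G ` arrows_from G D \<subseteq> D"
      proof
        fix x assume "x \<in> rng G ` arrows_from G D"
        then obtain g where g: "g \<in> arrows G" "src G g \<in> D" "x = rng G g"
          by (auto simp: arrows_from_def)
        \<comment> \<open>If \<open>h\<close> led from \<open>V\<close> to the range of
          \<open>g\<close>, then \<open>ginv G g \<odot> h\<close> would lead from \<open>V\<close>
          to the source of \<open>g\<close>, which lies in \<open>D\<close>.\<close>
        have "x \<notin> rng G ` arrows_from G V"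
        proof
          assume "x \<in> rng G ` arrows_from G V"
          then obtain h where h: "h \<in> arrows G" "src G h \<in> V" "x = rng G h"
            by (auto simp: arrows_from_def)
          have gh: "(ginv G g, h) \<in> composable G"
            using g h ginv_closed src_ginv by (simp add: composable_iff)
          then have "ginv G g \<odot> h \<in> arrows_from G V" "rng G (ginv G g \<odot> h) = src G g"
            using h g src_mult rng_mult rng_ginv mult_closed by (auto simp: arrows_from_def)
          then have "src G g \<in> rng G ` arrows_from G V" by (metis imageI)
          then show False using g by (simp add: D_def)
        qed
        then show "x \<in> D" using g rng_in_units by (simp add: D_def)
      qed
    qed
  qed
  moreover have "D \<noteq> units G"
    using V subset_rng_arrows_from[of V] openin_subset[OF V(1)] unfolding D_def by auto
  ultimately have "D = {}"
    using min unfolding minimal_def by blast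
  moreover have "rng G ` arrows_from G V \<subseteq> units G"
    using rng_in_units by (auto simp: arrows_from_def)
  ultimately show ?thesis unfolding D_def by blast
qed

lemma minimal_weakly_purely_infinite_imp_comparison:
  assumes inf: "infinite (units G)" and min: "minimal G" and wpi: "weakly_purely_infinite G"
  shows "groupoid_comparison G \<and> invariant_measures G = {}"
proof -
  have all: "open_subequiv G U V" if UV: "openin (unit_top G) U" "openin (unit_top G) V" "V \<noteq> {}" for U V
  proof (cases "U = {}")
    case True
    \<comment> \<open>Weak pure infiniteness speaks of non-empty sets only; the empty set is handled
      by the empty family of bisections.\<close>
    have "compact_subequiv G {} V"
      by (rule compact_subequivI[where I = "{} :: nat set"]) (auto simp: disjoint_family_on_def)
    with True show ?thesis by (simp add: open_subequiv_def)
  next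
    case False
    then show ?thesis
      using wpi UV minimal_rng_arrows_from[OF min UV(2,3)] openin_subset[OF UV(1)]
      unfolding weakly_purely_infinite_def by simp
  qed
  have U: "openin (unit_top G) (units G)"
    using openin_topspace[of "unit_top G"] by simp
  obtain a b where ab: "a \<in> units G" "b \<in> units G" "a \<noteq> b"
    using inf by (metis infinite_arbitrarily_large card_2_iff insert_subset)
  then obtain V1 V2 where V: "openin (unit_top G) V1" "openin (unit_top G) V2" "V1 \<noteq> {}" "V2 \<noteq> {}"
    "V1 \<inter> V2 = {}"
    using disjoint_open_subsets U by metis
  have False if mu: "\<mu> \<in> invariant_measures G" for \<mu>
  proof -
    have reg: "regular_borel_prob_measure (unit_top G) \<mu>"
      using mu by (simp add: invariant_measures_def)
    then interpret prob_space \<mu> by (simp add: regular_borel_prob_measure_def)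
    have sp: "space \<mu> = units G" and st: "\<And>W. openin (unit_top G) W \<Longrightarrow> W \<in> sets \<mu>"
      using reg unfolding regular_borel_prob_measure_def borel_sets_of_def
      by (auto intro: sigma_sets.Basic)
    \<comment> \<open>The whole unit space, of mass 1, lies below both \<open>V1\<close> and
      \<open>V2\<close>, so their disjoint union would have mass at least 2.\<close>
    have "1 \<le> emeasure \<mu> V1" "1 \<le> emeasure \<mu> V2"
      using invariant_measure_mono[OF mu U _ all] U V emeasure_space_1 sp by fastforce+
    then have "1 + 1 \<le> emeasure \<mu> V1 + emeasure \<mu> V2"
      by (rule add_mono)
    also have "\<dots> = emeasure \<mu> (V1 \<union> V2)"
      using V st by (intro plus_emeasure) auto
    also have "\<dots> \<le> 1" by (rule emeasure_le_1)
    finally show False by simp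
  qed
  then show ?thesis
    using all unfolding groupoid_comparison_def by blast
qed

end

theorem theorem5p1:
  fixes G :: "'a groupoid_struct"
  assumes "lch_etale_groupoid G" and "infinite (units G)"
  shows
    "(groupoid_comparison G \<and> invariant_measures G = {} \<longrightarrow> purely_infinite G) \<and>
     (purely_infinite G \<longleftrightarrow> paradoxical_comparison G) \<and>
     (paradoxical_comparison G \<longrightarrow> weakly_purely_infinite G) \<and>
     (minimal G \<longrightarrow>
        (groupoid_comparison G \<and> invariant_measures G = {} \<longleftrightarrow> purely_infinite G) \<and>
        (purely_infinite G \<longleftrightarrow> paradoxical_comparison G) \<and>
        (paradoxical_comparison G \<longleftrightarrow> weakly_purely_infinite G))"
proof -
  interpret lch_etale_groupoid G by fact
  show ?thesis
    using comparison_imp_purely_infinite[OF assms(2)]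
      purely_infinite_imp_paradoxical_comparison paradoxical_comparison_imp_purely_infinite
      purely_infinite_imp_weakly_purely_infinite
      minimal_weakly_purely_infinite_imp_comparison[OF assms(2)]
    by blast
qed

end
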